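(* Let $K$ be a field of characteristic $p>0$ and $P_n=K[x_1,\ldots,x_n]$ a polynomial algebra. For each $\sigma\in\operatorname{Aut}_K(P_n)$ and each $a\in P_n$, $$\sigma^{-1}(a)=\sum_{\alpha\in\mathbb{N}^n}\phi_\sigma\big({\partial'}^{[\alpha]}(a)\big)\,x^\alpha ,$$ where ${\partial'}^{[\alpha]}$ and $\phi_\sigma$ are defined in the context.
   Context: $\mathbb{N}=\{0,1,2,\ldots\}$ and $x^\alpha=x_1^{\alpha_1}\cdots x_n^{\alpha_n}$. Given $\sigma\in\operatorname{Aut}_K(P_n)$ put $x_i':=\sigma(x_i)$, so $P_n=K[x_1',\ldots,x_n']$, and ${x'}^\beta:={x_1'}^{\beta_1}\cdots{x_n'}^{\beta_n}$. The higher derivations with respect to the generators $x_1',\ldots,x_n'$ are the $K$-linear maps ${\partial'}^{[\alpha]}=\prod_{i=1}^n{\partial_i'}^{[\alpha_i]}:P_n\to P_n$ (formally ${\partial'}^{\alpha}/\alpha!$ with $\partial_i'=\partial/\partial x_i'$) given by ${\partial'}^{[\alpha]}({x'}^\beta)=\prod_{i=1}^n\binom{\beta_i}{\alpha_i}\,{x'}^{\beta-\alpha}$, which is $0$ if some $\beta_i<\alpha_i$; ${\partial_i'}^{[j]}$ is the one for $\alpha$ having $j$ in position $i$ and $0$ elsewhere. For $1\le i\le n$ and $k\ge 0$ put $$\phi_{i,k}':=\sum_{j=0}^{p-1}(-1)^j\frac{{x_i'}^{p^kj}}{j!}\big({\partial_i'}^{[p^k]}\big)^j,\qquad \phi_i':=\cdots\phi_{i,k}'\cdots\phi_{i,1}'\phi_{i,0}':P_n\to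 P_n .$$ The infinite product makes sense: if $u\in P_n$ has degree $<p^{k+1}$ in $x_i'$ then $\phi_i'(u)=\phi_{i,k}'\cdots\phi_{i,0}'(u)$, all further factors acting on this element as the identity. The maps $\phi_i'$ commute, and $\phi_\sigma:=\prod_{i=1}^n\phi_i'$. *)

theory Defs
  imports "HOL-Library.Poly_Mapping" "HOL-Library.Groups_Big_Fun"
    "HOL-Computational_Algebra.Computational_Algebra"
begin

text \<open>
  The polynomial algebra \<open>K[x\<^sub>i | i \<in> 'n]\<close>: finitely supported functions on the exponent
  monoid \<open>'n \<Rightarrow>\<^sub>0 nat\<close>, with the convolution product of \<^theory>\<open>HOL-Library.Poly_Mapping\<close>.
  The finite index type \<open>'n\<close> plays the role of \<open>{1, \<dots>, n}\<close>.
\<close>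

type_synonym 'n expo = "'n \<Rightarrow>\<^sub>0 nat"
type_synonym ('n, 'k) mpol = "('n \<Rightarrow>\<^sub>0 nat) \<Rightarrow>\<^sub>0 'k"

definition const :: "'k::field \<Rightarrow> ('n, 'k) mpol" where
  "const c = Poly_Mapping.single 0 c"

definition var :: "'n \<Rightarrow> ('n, 'k::field) mpol" where
  "var i = Poly_Mapping.single (Poly_Mapping.single i 1) 1"

definition scale :: "'k::field \<Rightarrow> ('n, 'k) mpol \<Rightarrow> ('n, 'k) mpol" where
  "scale c u = const c * u"

definition monom_in :: "('n::finite \<Rightarrow> ('n, 'k::field) mpol) \<Rightarrow> 'n expo \<Rightarrow> ('n, 'k) mpol" where
  "monom_in y \<beta> = (\<Prod>i\<in>UNIV. y i ^ Poly_Mapping.lookup \<beta> i)"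

definition alg_aut :: "(('n, 'k::field) mpol \<Rightarrow> ('n, 'k) mpol) \<Rightarrow> bool" where
  "alg_aut \<sigma> \<longleftrightarrow> bij \<sigma> \<and> (\<forall>u v. \<sigma> (u + v) = \<sigma> u + \<sigma> v) \<and> (\<forall>u v. \<sigma> (u * v) = \<sigma> u * \<sigma> v)
     \<and> (\<forall>c. \<sigma> (const c) = const c)"

text \<open>
  In the following \<open>y\<close> is a family of free generators of the polynomial algebra (later
  \<open>y i = \<sigma> (var i)\<close>), so that the monomials \<open>monom_in y \<beta>\<close> are a basis and the linear
  map below is unique. Where \<open>\<beta> - \<alpha>\<close> is truncated, the binomial product vanishes.
\<close>

definition hder :: "('n::finite \<Rightarrow> ('n, 'k::field) mpol) \<Rightarrow> 'n expo
    \<Rightarrow> ('n, 'k) mpol \<Rightarrow> ('n, 'k) mpol" where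
  "hder y \<alpha> = (THE D. Vector_Spaces.linear scale scale D \<and>
     (\<forall>\<beta>. D (monom_in y \<beta>) =
        scale (\<Prod>i\<in>UNIV. of_nat (Poly_Mapping.lookup \<beta> i choose Poly_Mapping.lookup \<alpha> i))
          (monom_in y (\<beta> - \<alpha>))))"

definition phi_ik :: "nat \<Rightarrow> ('n::finite \<Rightarrow> ('n, 'k::field) mpol) \<Rightarrow> 'n \<Rightarrow> nat
    \<Rightarrow> ('n, 'k) mpol \<Rightarrow> ('n, 'k) mpol" where
  "phi_ik p y i k u = (\<Sum>j<p. scale ((-1) ^ j / of_nat (fact j))
     (y i ^ (p ^ k * j) * (hder y (Poly_Mapping.single i (p ^ k)) ^^ j) u))"

primrec phi_upto :: "nat \<Rightarrow> ('n::finite \<Rightarrow> ('n, 'k::field) mpol) \<Rightarrow> 'n \<Rightarrow> nat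
    \<Rightarrow> ('n, 'k) mpol \<Rightarrow> ('n, 'k) mpol" where
  "phi_upto p y i 0 = phi_ik p y i 0"
| "phi_upto p y i (Suc k) = phi_ik p y i (Suc k) \<circ> phi_upto p y i k"

text \<open>
  The infinite composition \<open>\<dots> \<circ> phi_ik p y i 1 \<circ> phi_ik p y i 0\<close>: for each polynomial \<open>u\<close>
  the finite compositions applied to \<open>u\<close> are eventually constant.
\<close>

definition phi_i :: "nat \<Rightarrow> ('n::finite \<Rightarrow> ('n, 'k::field) mpol) \<Rightarrow> 'n
    \<Rightarrow> ('n, 'k) mpol \<Rightarrow> ('n, 'k) mpol" where
  "phi_i p y i u = (THE v. \<exists>k\<^sub>0. \<forall>k\<ge>k\<^sub>0. phi_upto p y i k u = v)"

text \<open>The maps \<open>phi_i p y i\<close> commute, so the order of composition in the fold is immaterial.\<close>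

definition phi :: "nat \<Rightarrow> ('n::finite \<Rightarrow> ('n, 'k::field) mpol)
    \<Rightarrow> ('n, 'k) mpol \<Rightarrow> ('n, 'k) mpol" where
  "phi p y = Finite_Set.fold (\<lambda>i f. phi_i p y i \<circ> f) id UNIV"

end

theory Submission
  imports Defs
begin

text \<open>
  The monomials \<open>x'\<^sup>\<beta>\<close> form a basis of \<open>P\<^sub>n\<close>, being the images of the monomials \<open>x\<^sup>\<beta>\<close>
  under \<open>\<sigma>\<close>. So if \<open>a = \<Sum>\<alpha>. c\<^sub>\<alpha> x'\<^sup>\<alpha>\<close> with \<open>c\<^sub>\<alpha>\<close> in \<open>K\<close>, then the inverse of \<open>\<sigma>\<close>
  maps \<open>a\<close> to \<open>\<Sum>\<alpha>. c\<^sub>\<alpha> x\<^sup>\<alpha>\<close>, and what has to be seen is that \<open>\<phi>\<^sub>\<sigma> (\<partial>'\<^bsup>[\<alpha>]\<^esup> a) = c\<^sub>\<alpha>\<close>.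
  Since the constant term of \<open>\<partial>'\<^bsup>[\<alpha>]\<^esup> a\<close> in the variables \<open>x'\<close> is \<open>c\<^sub>\<alpha>\<close>, just as in a
  Taylor expansion, this says that \<open>\<phi>\<^sub>\<sigma>\<close> is the projection onto constant terms.

  Every operator involved is determined by its effect on coordinates in the basis \<open>x'\<^sup>\<beta>\<close>,
  and \<open>\<phi>'\<^sub>i\<^sub>,\<^sub>k\<close> is diagonal. Modulo \<open>p\<close> the coefficient \<open>b choose p\<^sup>k\<close> is
  \<open>q = b div p\<^sup>k\<close> (\<open>of_nat_choose_prime_power\<close>), so applying the \<open>i\<close>-th derivation of
  order \<open>p\<^sup>k\<close> \<open>j\<close> times and then multiplying by the power \<open>p\<^sup>k j\<close> of \<open>x\<^sub>i'\<close> turns \<open>x'\<^sup>\<beta>\<close>,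
  where \<open>\<beta>\<^sub>i = b\<close>, into its multiple by the falling factorial
  \<open>q (q - 1) \<dots> (q - j + 1)\<close>. The eigenvalue of \<open>\<phi>'\<^sub>i\<^sub>,\<^sub>k\<close> is therefore the sum of
  \<open>(-1)\<^sup>j (q choose j)\<close> over \<open>j < p\<close>. By periodicity in \<open>q\<close> modulo \<open>p\<close> and the binomial
  theorem for \<open>(1 - 1)\<^sup>q\<close> it is \<open>1\<close> if \<open>p\<close> divides \<open>q\<close> and \<open>0\<close> otherwise
  (\<open>alternating_choose_sum_below_char\<close>). In other words, \<open>\<phi>'\<^sub>i\<^sub>,\<^sub>k\<close> keeps the monomials for
  which the \<open>k\<close>-th digit of \<open>\<beta>\<^sub>i\<close> in base \<open>p\<close> vanishes and kills the others; the product
  over \<open>k\<close> keeps those with \<open>\<beta>\<^sub>i = 0\<close>, and the product over \<open>i\<close> keeps only \<open>\<beta> = 0\<close>.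
\<close>

alias lookup = Poly_Mapping.lookup
alias keys = Poly_Mapping.keys

section \<open>Binomial coefficients in characteristic \<open>p\<close>\<close>

text \<open>
  From \<open>i * (p\<^sup>k choose i) = p\<^sup>k * ((p\<^sup>k - 1) choose (i - 1))\<close>: were the coefficient prime to
  \<open>p\<close>, then \<open>p\<^sup>k\<close> would divide \<open>i < p\<^sup>k\<close>.
\<close>

lemma prime_dvd_prime_power_choose:
  fixes p :: nat
  assumes "prime p" "0 < i" "i < p ^ k"
  shows "p dvd (p ^ k choose i)"
proof (rule ccontr)
  assume "\<not> p dvd (p ^ k choose i)"
  then have "coprime (p ^ k) (p ^ k choose i)"
    using \<open>prime p\<close> by (simp add: prime_imp_coprime)
  moreover have "i * (p ^ k choose i) = p ^ k * ((p ^ k - 1) choose (i - 1))"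
    using times_binomial_minus1_eq[OF \<open>0 < i\<close>] by simp
  then have "p ^ k dvd i * (p ^ k choose i)"
    by simp
  ultimately have "p ^ k dvd i"
    by (simp add: coprime_dvd_mult_left_iff)
  then show False
    using assms by (auto dest: dvd_imp_le)
qed

text \<open>
  Comparison of the coefficients of \<open>X\<^sup>r\<close> in \<open>(1 + X)\<^sup>m (1 + X)\<^bsup>p^k\<^esup> = (1 + X)\<^sup>m (1 + X\<^bsup>p^k\<^esup>)\<close>,
  that is, Vandermonde's identity where only the two outer coefficients \<open>p\<^sup>k choose 0\<close> and
  \<open>p\<^sup>k choose p\<^sup>k\<close> survive.
\<close>

lemma of_nat_choose_add_prime_power:
  assumes "CHAR('k::field) = p" "p > 0" "r \<le> p ^ k"
  shows "(of_nat ((m + p ^ k) choose r) :: 'k)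
    = of_nat (m choose r) + (if r = p ^ k then 1 else 0)"
proof -
  have p: "prime p"
    using assms prime_CHAR_semidom[where ?'a = 'k] by simp
  have zero: "(of_nat (p ^ k choose (r - j)) :: 'k) = 0" if "j < r" "0 < j \<or> r < p ^ k" for j
  proof -
    have "p dvd (p ^ k choose (r - j))"
      using that assms by (intro prime_dvd_prime_power_choose[OF p]) auto
    then show ?thesis
      using assms by (simp add: of_nat_eq_0_iff_char_dvd)
  qed
  have "((m + p ^ k) choose r) = (\<Sum>j\<le>r. (m choose j) * (p ^ k choose (r - j)))"
    by (rule vandermonde[symmetric])
  then have "(of_nat ((m + p ^ k) choose r) :: 'k)
      = (\<Sum>j\<le>r. of_nat (m choose j) * of_nat (p ^ k choose (r - j)))"
    by simp
  also have "\<dots> = (\<Sum>j\<le>r. (if j = r then of_nat (m choose r) else 0)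
      + (if j = 0 then (if r = p ^ k then 1 else 0) else 0))"
  proof (rule sum.cong[OF refl])
    fix j assume "j \<in> {..r}"
    have "p ^ k > 0" using \<open>p > 0\<close> by simp
    then show "(of_nat (m choose j) * of_nat (p ^ k choose (r - j)) :: 'k)
        = (if j = r then of_nat (m choose r) else 0)
          + (if j = 0 then (if r = p ^ k then 1 else 0) else 0)"
      using \<open>j \<in> {..r}\<close> zero[of j] assms(3) by (cases "j = r"; cases "j = 0") auto
  qed
  also have "\<dots> = of_nat (m choose r) + (if r = p ^ k then 1 else 0)"
    by (simp add: sum.distrib)
  finally show ?thesis .
qed

text \<open>
  A case of Lucas' theorem: the number of times \<open>p\<^sup>k\<close> can be subtracted from \<open>b\<close> is counted by
  the recursion \<open>of_nat_choose_add_prime_power\<close>.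
\<close>

lemma of_nat_choose_prime_power:
  assumes "CHAR('k::field) = p" "p > 0"
  shows "(of_nat (b choose p ^ k) :: 'k) = of_nat (b div p ^ k)"
proof -
  have "(of_nat ((r + q * p ^ k) choose p ^ k) :: 'k) = of_nat q" if "r < p ^ k" for q r
  proof (induction q)
    case 0
    show ?case using that by (simp add: binomial_eq_0)
  next
    case (Suc q)
    have "(of_nat ((r + q * p ^ k + p ^ k) choose p ^ k) :: 'k) = of_nat q + 1"
      using of_nat_choose_add_prime_power[OF assms order_refl, of "r + q * p ^ k" k] Suc
      by simp
    then show ?case by (simp add: algebra_simps)
  qed
  from this[of "b mod p ^ k" "b div p ^ k"] show ?thesis
    using \<open>p > 0\<close> by (simp only: mod_div_mult_eq mod_less_divisor zero_less_power)
qed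

text \<open>
  For \<open>j < p\<close> the coefficient \<open>q choose j\<close> in \<open>K\<close> depends only on \<open>q\<close> modulo \<open>p\<close>. Once \<open>q < p\<close>,
  the range of the sum covers the whole binomial expansion of \<open>(1 - 1)\<^sup>q\<close>.
\<close>

lemma alternating_choose_sum_below_char:
  assumes "CHAR('k::field) = p" "p > 0"
  shows "(\<Sum>j<p. (-1) ^ j * of_nat (q choose j) :: 'k) = (if p dvd q then 1 else 0)"
proof -
  have base: "(\<Sum>j<p. (-1) ^ j * of_nat (r choose j) :: 'k) = (if r = 0 then 1 else 0)"
    if "r < p" for r
  proof -
    have "(\<Sum>j<p. (-1) ^ j * of_nat (r choose j) :: 'k)
        = (\<Sum>j\<le>r. (-1) ^ j * of_nat (r choose j))"
      using that by (intro sum.mono_neutral_right) (auto simp: binomial_eq_0 not_le)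
    then show ?thesis
      using choose_alternating_sum[of r, where ?'a = 'k] by auto
  qed
  have "(\<Sum>j<p. (-1) ^ j * of_nat ((r + n * p) choose j) :: 'k)
      = (\<Sum>j<p. (-1) ^ j * of_nat (r choose j))" for r n
  proof (induction n)
    case (Suc n)
    have "(of_nat ((r + n * p + p) choose j) :: 'k) = of_nat ((r + n * p) choose j)" if "j < p" for j
      using of_nat_choose_add_prime_power[OF assms, of j 1 "r + n * p"] that by simp
    then show ?case
      using Suc by (simp add: algebra_simps)
  qed simp
  from this[of "q mod p" "q div p"] base[of "q mod p"] show ?thesis
    using \<open>p > 0\<close> by (auto simp: dvd_eq_mod_eq_0)
qed

section \<open>Coefficients of polynomials\<close>

lemma poly_mapping_sum_singles: "f = (\<Sum>k\<in>keys f. Poly_Mapping.single k (lookup f k))"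
  by (rule poly_mapping_eqI) (simp add: lookup_sum lookup_single when_def in_keys_iff)

lemma lookup_single_times:
  fixes f :: "'a::cancel_comm_monoid_add \<Rightarrow>\<^sub>0 'b::semiring_0"
  shows "lookup (Poly_Mapping.single a c * f) (a + b) = c * lookup f b"
proof -
  have "Poly_Mapping.single a c * f
      = (\<Sum>k\<in>keys f. Poly_Mapping.single (a + k) (c * lookup f k))"
    by (subst poly_mapping_sum_singles[of f]) (simp add: sum_distrib_left mult_single)
  then show ?thesis
    by (auto simp: lookup_sum lookup_single when_def in_keys_iff)
qed

lemma lookup_single_times_eq_0:
  fixes f :: "'a::cancel_comm_monoid_add \<Rightarrow>\<^sub>0 'b::semiring_0"
  assumes "\<And>b. d \<noteq> a + b"
  shows "lookup (Poly_Mapping.single a c * f) d = 0"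
proof -
  have "Poly_Mapping.single a c * f
      = (\<Sum>k\<in>keys f. Poly_Mapping.single (a + k) (c * lookup f k))"
    by (subst poly_mapping_sum_singles[of f]) (simp add: sum_distrib_left mult_single)
  then show ?thesis
    using assms[symmetric] by (simp add: lookup_sum lookup_single when_def)
qed

lemma lookup_scale: "lookup (scale c u) \<beta> = c * lookup u \<beta>"
  using lookup_single_times[of 0 c u \<beta>] by (simp add: scale_def const_def)

lemma vector_space_scale:
  "vector_space (scale :: 'k::field \<Rightarrow> ('n, 'k) mpol \<Rightarrow> ('n, 'k) mpol)"
  by unfold_locales
    (auto intro!: poly_mapping_eqI simp: lookup_scale lookup_add algebra_simps)

lemma var_power: "var i ^ m = Poly_Mapping.single (Poly_Mapping.single i m) 1"
  by (induction m) (auto simp: var_def mult_single single_add[symmetric])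

lemma monom_in_var: "monom_in var \<beta> = Poly_Mapping.single \<beta> 1"
proof -
  have "(\<Prod>i\<in>A. Poly_Mapping.single (Poly_Mapping.single i (lookup \<beta> i)) (1::'b::field))
      = Poly_Mapping.single (\<Sum>i\<in>A. Poly_Mapping.single i (lookup \<beta> i)) 1" for A :: "'a set"
    by (induction A rule: infinite_finite_induct) (auto simp: mult_single)
  moreover have "(\<Sum>i\<in>UNIV. Poly_Mapping.single i (lookup \<beta> i)) = \<beta>"
    by (rule poly_mapping_eqI) (simp add: lookup_sum lookup_single when_def)
  ultimately show ?thesis
    by (simp add: monom_in_def var_power)
qed

section \<open>Coordinates with respect to the images of the variables\<close>

locale polynomial_automorphism =
  fixes \<sigma> :: "('n::finite, 'k::field) mpol \<Rightarrow> ('n, 'k) mpol"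
  assumes aut: "alg_aut \<sigma>"
begin

text \<open>
  The coefficient of \<open>x'\<^sup>\<beta>\<close> in \<open>u\<close>: applying the inverse of \<open>\<sigma>\<close> turns an expansion in the
  \<open>x'\<^sup>\<beta>\<close> into one in the \<open>x\<^sup>\<beta>\<close>, whose coefficients can be read off.
\<close>

definition coord :: "('n, 'k) mpol \<Rightarrow> 'n expo \<Rightarrow> 'k" where
  "coord u \<beta> = lookup (inv \<sigma> u) \<beta>"

text \<open>The generators \<open>x\<^sub>1', \<dots>, x\<^sub>n'\<close>.\<close>

abbreviation gen :: "'n \<Rightarrow> ('n, 'k) mpol" where
  "gen \<equiv> \<lambda>i. \<sigma> (var i)"

lemma bij: "bij \<sigma>"
  using aut by (simp add: alg_aut_def)

lemma inv_apply [simp]: "inv \<sigma> (\<sigma> u) = u"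
  using bij by (simp add: bij_is_inj)

lemma apply_inv [simp]: "\<sigma> (inv \<sigma> u) = u"
  using bij by (simp add: bij_is_surj surj_f_inv_f)

lemma inv_eqI: "\<sigma> v = u \<Longrightarrow> inv \<sigma> u = v"
  by auto

lemma apply_add: "\<sigma> (u + v) = \<sigma> u + \<sigma> v"
  and apply_mult: "\<sigma> (u * v) = \<sigma> u * \<sigma> v"
  and apply_const: "\<sigma> (const c) = const c"
  using aut by (auto simp: alg_aut_def)

lemma apply_1: "\<sigma> 1 = 1"
  using apply_const[of 1] by (simp add: const_def)

lemma apply_power: "\<sigma> (u ^ m) = \<sigma> u ^ m"
  by (induction m) (auto simp: apply_1 apply_mult)

lemma apply_prod: "\<sigma> (prod f A) = (\<Prod>i\<in>A. \<sigma> (f i))"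
  by (induction A rule: infinite_finite_induct) (auto simp: apply_1 apply_mult)

lemma apply_monom_in: "\<sigma> (Poly_Mapping.single \<beta> 1) = monom_in gen \<beta>"
  unfolding monom_in_var[symmetric] by (simp add: monom_in_def apply_prod apply_power)

lemma inv_add: "inv \<sigma> (u + v) = inv \<sigma> u + inv \<sigma> v"
  by (rule inv_eqI) (simp add: apply_add)

lemma inv_mult: "inv \<sigma> (u * v) = inv \<sigma> u * inv \<sigma> v"
  by (rule inv_eqI) (simp add: apply_mult)

lemma coord_eqI: "(\<And>\<beta>. coord u \<beta> = coord v \<beta>) \<Longrightarrow> u = v"
  unfolding coord_def by (metis apply_inv poly_mapping_eqI)

lemma coord_add: "coord (u + v) \<beta> = coord u \<beta> + coord v \<beta>"
  by (simp add: coord_def inv_add lookup_add)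

lemma coord_0: "coord 0 \<beta> = 0"
  using coord_add[of 0 0 \<beta>] by (metis add_0 add_cancel_left_left)

lemma coord_sum: "coord (sum f A) \<beta> = (\<Sum>i\<in>A. coord (f i) \<beta>)"
  by (induction A rule: infinite_finite_induct) (auto simp: coord_0 coord_add)

lemma coord_scale: "coord (scale c u) \<beta> = c * coord u \<beta>"
proof -
  have "inv \<sigma> (scale c u) = scale c (inv \<sigma> u)"
    by (rule inv_eqI) (simp add: scale_def apply_mult apply_const)
  then show ?thesis
    by (simp add: coord_def lookup_scale)
qed

lemma coord_monom_in:
  "coord (monom_in gen \<beta>) \<gamma> = (if \<beta> = \<gamma> then 1 else 0)"
  by (simp add: coord_def apply_monom_in[symmetric] lookup_single when_def)

lemma finite_coord_support: "finite {\<beta>. coord u \<beta> \<noteq> 0}"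
  by (simp add: coord_def)

lemma coord_power_times:
  "coord (\<sigma> (var i) ^ m * u) \<beta>
    = (if m \<le> lookup \<beta> i then coord u (\<beta> - Poly_Mapping.single i m) else 0)"
proof -
  have inv: "inv \<sigma> (\<sigma> (var i) ^ m * u) = Poly_Mapping.single (Poly_Mapping.single i m) 1 * inv \<sigma> u"
    by (simp add: inv_mult flip: apply_power var_power)
  show ?thesis
  proof (cases "m \<le> lookup \<beta> i")
    case True
    then have "\<beta> = Poly_Mapping.single i m + (\<beta> - Poly_Mapping.single i m)"
      by (auto intro!: poly_mapping_eqI simp: lookup_add lookup_minus lookup_single when_def)
    then show ?thesis
      using True lookup_single_times[of "Poly_Mapping.single i m" 1 "inv \<sigma> u" "\<beta> - Poly_Mapping.single i m"]
      by (simp add: coord_def inv)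
  next
    case False
    then have "\<beta> \<noteq> Poly_Mapping.single i m + \<gamma>" for \<gamma>
      by (auto simp: lookup_add)
    then show ?thesis
      using False by (simp add: coord_def inv lookup_single_times_eq_0)
  qed
qed

lemma expand_monom_in:
  "u = (\<Sum>\<beta>\<in>keys (inv \<sigma> u). scale (coord u \<beta>) (monom_in gen \<beta>))"
  by (rule coord_eqI)
    (simp add: coord_sum coord_scale coord_monom_in if_distrib cong: if_cong, simp add: coord_def in_keys_iff)

text \<open>The uniqueness that the definite description in \<open>hder\<close> presupposes.\<close>

lemma linear_eqI_monom_in:
  assumes "Vector_Spaces.linear scale scale D" "Vector_Spaces.linear scale scale E"
    and "\<And>\<beta>. D (monom_in gen \<beta>) = E (monom_in gen \<beta>)"
  shows "D = E"
proof
  fix u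
  interpret D: Vector_Spaces.linear scale scale D by fact
  interpret E: Vector_Spaces.linear scale scale E by fact
  show "D u = E u"
    by (subst (1 2) expand_monom_in[of u]) (simp add: D.sum D.scale E.sum E.scale assms(3))
qed

section \<open>Higher derivations and projections in coordinates\<close>

text \<open>
  The sum of \<open>c\<^sub>\<gamma> \<Prod>\<^sub>i (\<gamma>\<^sub>i choose \<alpha>\<^sub>i) x'\<^bsup>\<gamma> - \<alpha>\<^esup>\<close> over \<open>\<gamma>\<close>, reindexed by \<open>\<gamma> = \<beta> + \<alpha>\<close>.
  In this form no truncated subtraction occurs, and the formula itself serves to construct
  the operator that the definite description in \<open>hder\<close> refers to.
\<close>

lemma coord_hder:
  "coord (hder gen \<alpha> u) \<beta>
    = (\<Prod>i\<in>UNIV. of_nat ((lookup \<beta> i + lookup \<alpha> i) choose lookup \<alpha> i))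
      * coord u (\<beta> + \<alpha>)"
proof -
  define c :: "'n expo \<Rightarrow> 'k" where
    "c \<beta> = (\<Prod>i\<in>UNIV. of_nat ((lookup \<beta> i + lookup \<alpha> i) choose lookup \<alpha> i))" for \<beta>
  define D where "D u = \<sigma> (Abs_poly_mapping (\<lambda>\<beta>. c \<beta> * coord u (\<beta> + \<alpha>)))" for u
  have coord_D: "coord (D u) \<beta> = c \<beta> * coord u (\<beta> + \<alpha>)" for u \<beta>
  proof -
    \<comment> \<open>\<open>Abs_poly_mapping\<close> is meaningful only on functions of finite support.\<close>
    have "finite {\<beta>. c \<beta> * coord u (\<beta> + \<alpha>) \<noteq> 0}"
    proof (rule finite_subset)
      show "{\<beta>. c \<beta> * coord u (\<beta> + \<alpha>) \<noteq> 0} \<subseteq> (\<lambda>\<gamma>. \<gamma> - \<alpha>) ` {\<gamma>. coord u \<gamma> \<noteq> 0}"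
        by (force intro!: image_eqI)
    qed (simp add: finite_coord_support)
    then show ?thesis
      by (simp add: D_def coord_def)
  qed
  have linear_D: "Vector_Spaces.linear scale scale D"
    unfolding Vector_Spaces.linear_iff
    by (auto intro!: vector_space_scale coord_eqI simp: coord_D coord_add coord_scale algebra_simps)
  have D_monom: "D (monom_in gen \<beta>)
      = scale (\<Prod>i\<in>UNIV. of_nat (lookup \<beta> i choose lookup \<alpha> i))
          (monom_in gen (\<beta> - \<alpha>))" for \<beta>
  proof (rule coord_eqI)
    fix \<gamma>
    show "coord (D (monom_in gen \<beta>)) \<gamma>
      = coord (scale (\<Prod>i\<in>UNIV. of_nat (lookup \<beta> i choose lookup \<alpha> i))
          (monom_in gen (\<beta> - \<alpha>))) \<gamma>"
    proof (cases "\<exists>i. lookup \<beta> i < lookup \<alpha> i")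
      case True
      then obtain i where "lookup \<beta> i < lookup \<alpha> i" ..
      then have "(\<Prod>i\<in>UNIV. of_nat (lookup \<beta> i choose lookup \<alpha> i) :: 'k) = 0"
        by (intro prod_zero bexI[of _ i]) (auto simp: binomial_eq_0)
      moreover have "\<beta> \<noteq> \<gamma> + \<alpha>"
        using True by (auto simp: lookup_add)
      ultimately show ?thesis
        by (simp add: coord_D coord_scale coord_monom_in)
    next
      case False
      then have lookup_diff: "lookup (\<beta> - \<alpha>) i + lookup \<alpha> i
          = lookup \<beta> i" for i
        by (simp add: lookup_minus not_less)
      then have "\<beta> = \<beta> - \<alpha> + \<alpha>"
        by (intro poly_mapping_eqI) (simp add: lookup_add)
      then have "\<beta> = \<gamma> + \<alpha> \<longleftrightarrow> \<beta> - \<alpha> = \<gamma>"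
        by (metis add_diff_cancel_right')
      then show ?thesis
        by (auto simp: coord_D coord_scale coord_monom_in c_def lookup_diff)
    qed
  qed
  have "hder gen \<alpha> = D"
    unfolding hder_def
    by (rule the_equality) (use linear_D D_monom in \<open>auto intro: linear_eqI_monom_in\<close>)
  then show ?thesis
    by (simp add: coord_D c_def)
qed

end

locale char_p_polynomial_automorphism = polynomial_automorphism \<sigma>
  for \<sigma> :: "('n::finite, 'k::field) mpol \<Rightarrow> ('n, 'k) mpol" +
  fixes p :: nat
  assumes char_p: "CHAR('k) = p" and p_pos: "p > 0"
begin

lemma of_nat_fact_neq_0: "j < p \<Longrightarrow> (of_nat (fact j) :: 'k) \<noteq> 0"
  using prime_CHAR_semidom[where ?'a = 'k] char_p p_pos
  by (simp only: of_nat_eq_0_iff_char_dvd) (simp add: prime_dvd_fact_iff)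

lemma prime_p: "prime p"
  using prime_CHAR_semidom[where ?'a = 'k] char_p p_pos by simp

text \<open>
  By \<open>of_nat_choose_prime_power\<close> the derivation of order \<open>p\<^sup>k\<close> acts on the \<open>k\<close>-th base \<open>p\<close>
  digit of an exponent as an ordinary derivative does on the exponent itself.
\<close>

lemma coord_hder_prime_power:
  "coord (hder gen (Poly_Mapping.single i (p ^ k)) u) \<beta>
    = of_nat (lookup \<beta> i div p ^ k + 1) * coord u (\<beta> + Poly_Mapping.single i (p ^ k))"
proof -
  have "(\<Prod>l\<in>UNIV. of_nat ((lookup \<beta> l + lookup (Poly_Mapping.single i (p ^ k)) l)
      choose lookup (Poly_Mapping.single i (p ^ k)) l) :: 'k)
    = (\<Prod>l\<in>UNIV. if l = i then of_nat ((lookup \<beta> i + p ^ k) choose p ^ k) else 1)"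
    by (rule prod.cong) (auto simp: lookup_single)
  also have "\<dots> = of_nat (lookup \<beta> i div p ^ k + 1)"
    using p_pos by (simp add: of_nat_choose_prime_power[OF char_p p_pos])
  finally show ?thesis
    by (simp add: coord_hder)
qed

text \<open>
  The numerical factor is \<open>(q + 1) \<dots> (q + j)\<close> with \<open>q = \<beta>\<^sub>i div p\<^sup>k\<close>; written with \<open>fact j\<close>
  it cancels the denominator in \<open>phi_ik\<close>.
\<close>

lemma coord_hder_prime_power_iterate:
  "coord ((hder gen (Poly_Mapping.single i (p ^ k)) ^^ j) u) \<beta>
    = of_nat (fact j * ((lookup \<beta> i div p ^ k + j) choose j))
      * coord u (\<beta> + Poly_Mapping.single i (p ^ k * j))"
proof (induction j arbitrary: \<beta>)
  case (Suc j)
  let ?e = "Poly_Mapping.single i (p ^ k)" and ?q = "lookup \<beta> i div p ^ k"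
  have shift: "\<beta> + ?e + Poly_Mapping.single i (p ^ k * j)
      = \<beta> + Poly_Mapping.single i (p ^ k * Suc j)"
    by (simp add: add.assoc flip: single_add)
  have "coord ((hder gen ?e ^^ Suc j) u) \<beta>
      = of_nat (Suc ?q) * (of_nat (fact j * ((Suc ?q + j) choose j))
        * coord u (\<beta> + Poly_Mapping.single i (p ^ k * Suc j)))"
    using p_pos by (simp only: funpow.simps comp_apply coord_hder_prime_power Suc.IH shift)
      (simp add: lookup_add)
  also have "\<dots> = of_nat (Suc ?q * (fact j * ((Suc ?q + j) choose j)))
        * coord u (\<beta> + Poly_Mapping.single i (p ^ k * Suc j))"
    by (simp only: of_nat_mult mult.assoc)
  also have "Suc ?q * (fact j * ((Suc ?q + j) choose j)) = fact (Suc j) * ((?q + Suc j) choose Suc j)"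
  proof -
    have "Suc ?q * ((Suc ?q + j) choose j) = Suc j * ((?q + Suc j) choose Suc j)"
      using binomial_absorb_comp[of "Suc ?q + j" j] binomial_absorption[of j "?q + Suc j"]
      by simp
    then show ?thesis
      by (simp only: fact_Suc of_nat_id mult.left_commute[of "Suc ?q"] mult.assoc)
         (simp only: mult.left_commute)
  qed
  finally show ?case .
qed simp

text \<open>The exponent \<open>\<beta>\<^sub>i\<close> passes exactly if its \<open>k\<close>-th digit in base \<open>p\<close> is \<open>0\<close>.\<close>

lemma coord_phi_ik:
  "coord (phi_ik p gen i k u) \<beta>
    = (if p dvd lookup \<beta> i div p ^ k then coord u \<beta> else 0)"
proof -
  let ?q = "lookup \<beta> i div p ^ k"
  let ?D = "hder gen (Poly_Mapping.single i (p ^ k))"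
  have "coord (scale ((-1) ^ j / of_nat (fact j)) (\<sigma> (var i) ^ (p ^ k * j) * (?D ^^ j) u)) \<beta>
      = (-1) ^ j * of_nat (?q choose j) * coord u \<beta>" if "j < p" for j
    \<comment> \<open>The cases are \<open>j \<le> ?q\<close> and \<open>?q < j\<close>; in the latter both sides are \<open>0\<close>.\<close>
  proof (cases "p ^ k * j \<le> lookup \<beta> i")
    case True
    let ?s = "Poly_Mapping.single i (p ^ k * j)"
    have "\<beta> - ?s + ?s = \<beta>"
      using True by (auto intro!: poly_mapping_eqI simp: lookup_add lookup_minus lookup_single when_def)
    moreover have "lookup (\<beta> - ?s) i div p ^ k + j = ?q"
    proof -
      obtain r where "lookup \<beta> i = p ^ k * j + r"
        using True by (auto simp: le_iff_add)
      then show ?thesis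
        using p_pos by (simp add: lookup_minus)
    qed
    ultimately show ?thesis
      using True of_nat_fact_neq_0[OF that]
      by (simp add: coord_scale coord_power_times coord_hder_prime_power_iterate)
  next
    case False
    then have "?q < j"
      using p_pos by (simp add: div_less_iff_less_mult mult.commute)
    then show ?thesis
      using False by (simp add: coord_scale coord_power_times binomial_eq_0)
  qed
  then have "coord (phi_ik p gen i k u) \<beta>
      = (\<Sum>j<p. (-1) ^ j * of_nat (?q choose j)) * coord u \<beta>"
    by (simp add: phi_ik_def coord_sum sum_distrib_right)
  then show ?thesis
    by (simp add: alternating_choose_sum_below_char[OF char_p p_pos])
qed

text \<open>The lowest \<open>k + 1\<close> digits in base \<open>p\<close> all vanish.\<close>

lemma coord_phi_upto:
  "coord (phi_upto p gen i k u) \<beta>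
    = (if p ^ Suc k dvd lookup \<beta> i then coord u \<beta> else 0)"
proof (induction k)
  case (Suc k)
  have "p ^ Suc (Suc k) dvd b \<longleftrightarrow> p dvd b div p ^ Suc k \<and> p ^ Suc k dvd b" for b :: nat
  proof (cases "p ^ Suc k dvd b")
    case True
    then obtain c where "b = p ^ Suc k * c" ..
    moreover have "p ^ Suc k > 0"
      using p_pos by simp
    ultimately show ?thesis
      by (simp only: power_Suc2[of p "Suc k"] dvd_times_left_cancel_iff
          nonzero_mult_div_cancel_left dvd_triv_left neq0_conv simp_thms)
  next
    case False
    then show ?thesis
      by (metis dvd_trans le_imp_power_dvd le_SucI order_refl)
  qed
  then show ?case
    by (simp only: phi_upto.simps comp_apply coord_phi_ik Suc.IH if_if_eq_conj)
qed (simp add: coord_phi_ik)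

text \<open>
  The compositions stabilise at \<open>u\<close> because its degree in \<open>x\<^sub>i'\<close> is bounded: once \<open>p\<^bsup>k + 1\<^esup>\<close>
  exceeds the bound, it divides an occurring exponent only if that exponent is \<open>0\<close>.
\<close>

lemma coord_phi_i:
  "coord (phi_i p gen i u) \<beta> = (if lookup \<beta> i = 0 then coord u \<beta> else 0)"
proof -
  let ?P = "phi_upto p gen i"
  have "finite ((\<lambda>\<beta>. lookup \<beta> i) ` {\<beta>. coord u \<beta> \<noteq> 0})"
    using finite_coord_support by blast
  then obtain k\<^sub>0 where k0: "lookup \<gamma> i \<le> k\<^sub>0" if "coord u \<gamma> \<noteq> 0" for \<gamma>
    by (auto simp: finite_nat_set_iff_bounded_le)
  have coord_P: "coord (?P k u) \<gamma> = (if lookup \<gamma> i = 0 then coord u \<gamma> else 0)"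
    if "k \<ge> k\<^sub>0" for k \<gamma>
  proof (cases "coord u \<gamma> = 0 \<or> lookup \<gamma> i = 0")
    case False
    have "lookup \<gamma> i \<le> Suc k"
      using False k0[of \<gamma>] that by simp
    also have "Suc k < p ^ Suc k"
      using prime_gt_1_nat[OF prime_p] by (intro power_gt_expt) simp
    finally have "\<not> p ^ Suc k dvd lookup \<gamma> i"
      using False by (auto dest: dvd_imp_le)
    then show ?thesis
      using False by (simp add: coord_phi_upto del: power_Suc)
  qed (auto simp: coord_phi_upto)
  then have stable: "?P k u = ?P k\<^sub>0 u" if "k \<ge> k\<^sub>0" for k
    using that by (intro coord_eqI) simp
  have "phi_i p gen i u = ?P k\<^sub>0 u"
    unfolding phi_i_def
  proof (rule the_equality)
    show "\<exists>k\<^sub>1. \<forall>k\<ge>k\<^sub>1. ?P k u = ?P k\<^sub>0 u"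
      using stable by blast
  next
    fix v assume "\<exists>k\<^sub>1. \<forall>k\<ge>k\<^sub>1. ?P k u = v"
    then obtain k\<^sub>1 where "?P k u = v" if "k \<ge> k\<^sub>1" for k by blast
    then show "v = ?P k\<^sub>0 u"
      using stable[of "max k\<^sub>0 k\<^sub>1"] by simp
  qed
  then show ?thesis
    by (simp add: coord_P)
qed

lemma phi_eq_const: "phi p gen u = const (coord u 0)"
proof (rule coord_eqI)
  fix \<beta>
  define F where "F = (\<lambda>i (f :: ('n, 'k) mpol \<Rightarrow> ('n, 'k) mpol). phi_i p gen i \<circ> f)"
  \<comment> \<open>Diagonal operators commute, so the fold can be unwound in any order.\<close>
  interpret comp_fun_commute F
    by standard (auto simp: F_def fun_eq_iff coord_phi_i intro!: coord_eqI)
  have "coord (Finite_Set.fold F id A u) \<beta>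
      = (if \<forall>i\<in>A. lookup \<beta> i = 0 then coord u \<beta> else 0)"
    for A
    using finite[of A]
  proof (induction A rule: finite_induct)
    case (insert i A)
    have "Finite_Set.fold F id (insert i A) u = phi_i p gen i (Finite_Set.fold F id A u)"
      by (simp add: fold_insert[OF insert.hyps]) (simp add: F_def)
    then show ?case
      by (simp only: coord_phi_i insert.IH ball_simps(7) if_if_eq_conj)
  qed simp
  then have "coord (phi p gen u) \<beta> = (if \<forall>i. lookup \<beta> i = 0 then coord u \<beta> else 0)"
    by (simp add: phi_def F_def)
  also have "(\<forall>i. lookup \<beta> i = 0) \<longleftrightarrow> \<beta> = 0"
    by (auto intro: poly_mapping_eqI)
  also have "(if \<beta> = 0 then coord u \<beta> else 0) = coord (const (coord u 0)) \<beta>"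
  proof -
    have "inv \<sigma> (const c) = const c" for c
      by (rule inv_eqI) (rule apply_const)
    then show ?thesis
      by (simp add: coord_def const_def lookup_single when_def)
  qed
  finally show "coord (phi p gen u) \<beta> = coord (const (coord u 0)) \<beta>" .
qed

text \<open>
  At \<open>\<beta> = 0\<close> the factors in \<open>coord_hder\<close> are \<open>\<alpha>\<^sub>i choose \<alpha>\<^sub>i\<close>, that is \<open>1\<close>.
\<close>

lemma phi_hder: "phi p gen (hder gen \<alpha> a) = const (coord a \<alpha>)"
  by (simp add: phi_eq_const coord_hder)

end

theorem theorem6p2:
  fixes \<sigma> :: "('n::finite, 'k::field) mpol \<Rightarrow> ('n, 'k) mpol"
    and a :: "('n, 'k) mpol"
    and p :: nat
    and x' :: "'n \<Rightarrow> ('n, 'k) mpol"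
  assumes "CHAR('k) = p" and "p > 0"
    and "alg_aut \<sigma>"
    and "\<And>i. x' i = \<sigma> (var i)"
  shows "finite {\<alpha>. phi p x' (hder x' \<alpha> a) * monom_in var \<alpha> \<noteq> 0}
    \<and> inv \<sigma> a = Sum_any (\<lambda>\<alpha>. phi p x' (hder x' \<alpha> a) * monom_in var \<alpha>)"
proof -
  interpret char_p_polynomial_automorphism \<sigma> p
    using assms by unfold_locales
  have x': "x' = (\<lambda>i. \<sigma> (var i))"
    using assms(4) by auto
  have summand: "phi p x' (hder x' \<alpha> a) * monom_in var \<alpha>
      = Poly_Mapping.single \<alpha> (lookup (inv \<sigma> a) \<alpha>)" for \<alpha>
    by (simp add: x' phi_hder monom_in_var const_def coord_def mult_single)
  have support: "{\<alpha>. phi p x' (hder x' \<alpha> a) * monom_in var \<alpha> \<noteq> 0} \<subseteq> keys (inv \<sigma> a)"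
    by (auto simp: summand in_keys_iff)
  have "inv \<sigma> a = (\<Sum>\<alpha>\<in>keys (inv \<sigma> a). phi p x' (hder x' \<alpha> a) * monom_in var \<alpha>)"
    unfolding summand by (rule poly_mapping_sum_singles)
  also have "\<dots> = Sum_any (\<lambda>\<alpha>. phi p x' (hder x' \<alpha> a) * monom_in var \<alpha>)"
    using support by (intro Sum_any.expand_superset[symmetric]) auto
  finally show ?thesis
    using finite_subset[OF support] by simp
qed

end
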